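(* Let $n\in\mathbb{N}$, $a_1,\dots,a_n\in\mathbb{R}$, and $s\in\mathcal{S}_\infty$. Let (P) be any one of the four properties: determinate, strictly determinate, strongly determinate, ultradeterminate. Then the following are equivalent: (i) $s$ has property (P). (ii) There exists $s'\in\mathfrak{T}_s$ which has property (P). (iii) All $s'\in\mathfrak{T}_s$ have property (P). That is, determinacy, strict determinacy, strong determinacy, and ultradeterminacy are preserved on the transport curves $\mathfrak{T}_s$.
   Context: $\mathcal{S}_\infty$ is the set of all moment sequences, i.e. real sequences $s=(s_\alpha)_{\alpha\in\mathbb{N}_0^n}$ for which there is a positive Borel measure $\mu$ on $\mathbb{R}^n$ with all polynomials $\mu$-integrable such that $s_\alpha=\int_{\mathbb{R}^n}x^\alpha\,d\mu(x)$ for all $\alpha$ ($\mu$ is then a representing measure of $s$). For $t\in\mathbb{R}$, $\mathfrak{t}_s(t)=(\mathfrak{t}_{s,\alpha}(t))_{\alpha\in\mathbb{N}_0^n}$ with $\mathfrak{t}_{s,\alpha}(t):=s_\alpha\exp(-\sum_{i=1}^na_i(\alpha_i+1)t)$. The transport curve is $\mathfrak{T}_s:=\mathfrak{t}_s(\mathfrak{I}_s)$ with $\mathfrak{I}_s:=\{t\in\mathbb{R}\mid\mathfrak{t}_s(t)\in\mathcal{S}_\infty\}$. A moment sequence $s$ with representing measure $\mu$ is called: determinate if its representing measure $\mu$ is unique; strictly determinate if it is determinate and $\mathbb{C}[x_1,\dots,x_n]$ is dense in $L^2(\mathbb{R}^n,d\mu)$; strongly determinate if it is determinate and $\mathbb{C}[x_1,\dots,x_n]$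 is dense in $L^2(\mathbb{R}^n,(1+x_i^2)\,d\mu)$ for all $i=1,\dots,n$; ultradeterminate if it is determinate and $\mathbb{C}[x_1,\dots,x_n]$ is dense in $L^2(\mathbb{R}^n,(1+x_1^2+\dots+x_n^2)\,d\mu)$. *)

theory Defs
  imports "HOL-Analysis.Analysis"
begin

text \<open>
  The dimension \<open>n \<ge> 1\<close> is the cardinality of the finite index type \<open>'n\<close>, so that \<open>\<real>\<^sup>n\<close> is
  \<open>real ^ 'n\<close> and a multi-index in \<open>\<nat>\<^sub>0\<^sup>n\<close> is a function \<open>'n \<Rightarrow> nat\<close>. Polynomials are taken as
  functions: \<open>real_polynomial_function\<close> on \<open>real ^ 'n\<close> gives \<open>\<real>[x\<^sub>1,\<dots>,x\<^sub>n]\<close>, and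
  \<open>polynomial_function\<close> from \<open>real ^ 'n\<close> to \<open>complex\<close> (real and imaginary part polynomial)
  gives \<open>\<complex>[x\<^sub>1,\<dots>,x\<^sub>n]\<close>.
\<close>

definition monomial :: "('n::finite \<Rightarrow> nat) \<Rightarrow> real ^ 'n \<Rightarrow> real" where
  "monomial \<alpha> x = (\<Prod>i\<in>UNIV. (x $ i) ^ \<alpha> i)"

definition representing_measure ::
  "(('n::finite \<Rightarrow> nat) \<Rightarrow> real) \<Rightarrow> (real ^ 'n) measure \<Rightarrow> bool" where
  "representing_measure s \<mu> \<longleftrightarrow>
     sets \<mu> = sets borel \<and>
     (\<forall>p. real_polynomial_function p \<longrightarrow> integrable \<mu> p) \<and>
     (\<forall>\<alpha>. s \<alpha> = (LINT x|\<mu>. monomial \<alpha> x))"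

definition moment_sequences :: "(('n::finite \<Rightarrow> nat) \<Rightarrow> real) set" where
  "moment_sequences = {s. \<exists>\<mu>. representing_measure s \<mu>}"

definition transport ::
  "real ^ 'n::finite \<Rightarrow> (('n \<Rightarrow> nat) \<Rightarrow> real) \<Rightarrow> real \<Rightarrow> ('n \<Rightarrow> nat) \<Rightarrow> real" where
  "transport a s t = (\<lambda>\<alpha>. s \<alpha> * exp (- (\<Sum>i\<in>UNIV. a $ i * (real (\<alpha> i) + 1) * t)))"

definition transport_domain :: "real ^ 'n::finite \<Rightarrow> (('n \<Rightarrow> nat) \<Rightarrow> real) \<Rightarrow> real set" where
  "transport_domain a s = {t. transport a s t \<in> moment_sequences}"

definition transport_curve ::
  "real ^ 'n::finite \<Rightarrow> (('n \<Rightarrow> nat) \<Rightarrow> real) \<Rightarrow> (('n \<Rightarrow> nat) \<Rightarrow> real) set" where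
  "transport_curve a s = transport a s ` transport_domain a s"

text \<open>
  Square-integrable functions are not identified modulo null sets; \<open>L2_norm\<close> is thus only a
  seminorm, which does not affect density.
\<close>

definition L2 :: "'a measure \<Rightarrow> ('a \<Rightarrow> complex) set" where
  "L2 M = {f \<in> borel_measurable M. integrable M (\<lambda>x. (cmod (f x))\<^sup>2)}"

definition L2_norm :: "'a measure \<Rightarrow> ('a \<Rightarrow> complex) \<Rightarrow> real" where
  "L2_norm M f = sqrt (LINT x|M. (cmod (f x))\<^sup>2)"

definition polynomials_dense_L2 :: "(real ^ 'n::finite) measure \<Rightarrow> bool" where
  "polynomials_dense_L2 M \<longleftrightarrow>
     (\<forall>p. polynomial_function p \<longrightarrow> p \<in> L2 M) \<and>
     (\<forall>f\<in>L2 M. \<forall>\<epsilon>>0. \<exists>p. polynomial_function p \<and> L2_norm M (\<lambda>x. f x - p x) < \<epsilon>)"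

definition determinate :: "(('n::finite \<Rightarrow> nat) \<Rightarrow> real) \<Rightarrow> bool" where
  "determinate s \<longleftrightarrow> (\<exists>!\<mu>. representing_measure s \<mu>)"

definition strictly_determinate :: "(('n::finite \<Rightarrow> nat) \<Rightarrow> real) \<Rightarrow> bool" where
  "strictly_determinate s \<longleftrightarrow> determinate s \<and>
     (\<exists>\<mu>. representing_measure s \<mu> \<and> polynomials_dense_L2 \<mu>)"

definition strongly_determinate :: "(('n::finite \<Rightarrow> nat) \<Rightarrow> real) \<Rightarrow> bool" where
  "strongly_determinate s \<longleftrightarrow> determinate s \<and>
     (\<exists>\<mu>. representing_measure s \<mu> \<and>
       (\<forall>i. polynomials_dense_L2 (density \<mu> (\<lambda>x. ennreal (1 + (x $ i)\<^sup>2)))))"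

definition ultradeterminate :: "(('n::finite \<Rightarrow> nat) \<Rightarrow> real) \<Rightarrow> bool" where
  "ultradeterminate s \<longleftrightarrow> determinate s \<and>
     (\<exists>\<mu>. representing_measure s \<mu> \<and>
       polynomials_dense_L2 (density \<mu> (\<lambda>x. ennreal (1 + (\<Sum>i\<in>UNIV. (x $ i)\<^sup>2)))))"

end

theory Submission imports Defs begin

text \<open>
  If \<open>\<mu>\<close> represents \<open>s\<close>, then the image of \<open>\<mu>\<close> under the dilation
  \<open>x\<^sub>i \<mapsto> exp (- a\<^sub>i t) x\<^sub>i\<close>, multiplied by \<open>exp (- (a\<^sub>1 + \<dots> + a\<^sub>n) t)\<close>, represents the
  transported sequence. This gives a bijection between the representing measures of \<open>s\<close> and
  those of \<open>transport a s t\<close>, with inverse given by \<open>- t\<close>. The dilation maps polynomials to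
  polynomials and changes each of the weights \<open>1\<close>, \<open>1 + x\<^sub>i\<^sup>2\<close>, \<open>1 + x\<^sub>1\<^sup>2 + \<dots> + x\<^sub>n\<^sup>2\<close> by a
  factor that is bounded above and below, so density of polynomials is preserved as well.
\<close>

section \<open>Dilations and transported measures\<close>

definition dilation :: "real ^ 'n::finite \<Rightarrow> real \<Rightarrow> real ^ 'n \<Rightarrow> real ^ 'n" where
  "dilation a t x = (\<chi> i. exp (- (a $ i * t)) * x $ i)"

text \<open>The constant density supplies the \<open>+ 1\<close> in the exponents
  \<open>\<alpha> i + 1\<close> of \<open>transport\<close>; the image under the dilation alone
  accounts only for \<open>\<alpha> i\<close>.\<close>

definition transport_measure ::
  "real ^ 'n::finite \<Rightarrow> real \<Rightarrow> (real ^ 'n) measure \<Rightarrow> (real ^ 'n) measure" where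
  "transport_measure a t \<mu> =
     density (distr \<mu> borel (dilation a t)) (\<lambda>_. ennreal (exp (- (\<Sum>i\<in>UNIV. a $ i * t))))"

lemma dilation_nth [simp]: "dilation a t x $ i = exp (- (a $ i * t)) * x $ i"
  by (simp add: dilation_def)

lemma dilation_minus [simp]:
  "dilation a (- t) (dilation a t x) = x" "dilation a t (dilation a (- t) x) = x"
  by (simp_all add: vec_eq_iff flip: mult.assoc exp_add)

lemma bounded_linear_dilation: "bounded_linear (dilation a t)"
  by (rule linear_conv_bounded_linear[THEN iffD1], rule linearI)
     (simp_all add: vec_eq_iff algebra_simps)

lemma polynomial_function_dilation: "polynomial_function (dilation a t)"
  by (intro polynomial_function_bounded_linear bounded_linear_dilation)

lemma measurable_dilation [measurable]: "dilation a t \<in> borel_measurable borel"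
  by (intro borel_measurable_continuous_onI linear_continuous_on bounded_linear_dilation)

lemma transport_0 [simp]: "transport a s 0 = s"
  by (simp add: transport_def)

lemma transport_minus [simp]: "transport a (transport a s t) (- t) = s"
  by (simp add: transport_def sum_negf mult.assoc flip: exp_add)

lemma sets_transport_measure [simp, measurable_cong]: "sets (transport_measure a t \<mu>) = sets borel"
  by (simp add: transport_measure_def)

text \<open>The two dilations compose to the identity and the two constant factors multiply to 1.
  The assumption on \<open>sets\<close> makes the image under the identity, taken in
  \<open>borel\<close>, equal to \<open>\<mu>\<close> as a measure.\<close>

lemma transport_measure_minus:
  assumes [measurable_cong]: "sets \<mu> = sets borel"
  shows "transport_measure a (- t) (transport_measure a t \<mu>) = \<mu>"
proof -
  let ?c = "\<lambda>t. ennreal (exp (- (\<Sum>i\<in>UNIV. a $ i * t)))"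
  have c: "?c t * ?c (- t) = 1"
    by (simp add: sum_negf flip: ennreal_mult exp_add)
  \<comment> \<open>The first constant density is moved out of the second image, so that both
    constants meet in a single density.\<close>
  have "transport_measure a (- t) (transport_measure a t \<mu>) =
    density (distr (distr \<mu> borel (dilation a t)) borel (dilation a (- t))) (\<lambda>_. ?c t * ?c (- t))"
    unfolding transport_measure_def
    by (subst density_distr[symmetric]) (simp_all add: density_density_eq comp_def)
  also have "\<dots> = distr \<mu> borel (\<lambda>x. x)"
    by (simp only: c density_1) (simp add: distr_distr comp_def)
  also have "\<dots> = \<mu>"
    by (metis assms distr_id2)
  finally show ?thesis .
qed

section \<open>Moments and determinacy under transport\<close>

lemma monomial_dilation:
  "monomial \<alpha> (dilation a t x) = exp (- (\<Sum>i\<in>UNIV. a $ i * real (\<alpha> i) * t)) * monomial \<alpha> x"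
  by (simp add: monomial_def power_mult_distrib prod.distrib exp_sum sum_negf[symmetric]
      exp_of_nat_mult[symmetric] mult_ac)

text \<open>Composition with a dilation preserves polynomials, hence integrability, and multiplies
  each monomial by a constant; this constant times the factor of \<open>transport_measure\<close> is
  the factor in \<open>transport\<close>.\<close>

lemma representing_measure_transport:
  assumes "representing_measure s \<mu>"
  shows "representing_measure (transport a s t) (transport_measure a t \<mu>)"
proof -
  let ?c = "exp (- (\<Sum>i\<in>UNIV. a $ i * t))"
  have [measurable_cong]: "sets \<mu> = sets borel"
    and int: "\<And>p. real_polynomial_function p \<Longrightarrow> integrable \<mu> p"
    and s: "\<And>\<alpha>. s \<alpha> = (LINT x|\<mu>. monomial \<alpha> x)"
    using assms by (auto simp: representing_measure_def)
  have "integrable (transport_measure a t \<mu>) p" if p: "real_polynomial_function p" for p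
  proof -
    have [measurable]: "p \<in> borel_measurable borel"
      using p by (intro borel_measurable_continuous_onI continuous_on_polymonial_function)
        (simp add: real_polynomial_function_eq)
    have "integrable \<mu> (\<lambda>x. p (dilation a t x))"
      using int[OF real_polynomial_function_compose[OF polynomial_function_dilation p]]
      by (simp add: comp_def)
    then show ?thesis
      by (simp add: transport_measure_def integrable_density integrable_distr_eq)
  qed
  moreover have "transport a s t \<alpha> = (LINT x|transport_measure a t \<mu>. monomial \<alpha> x)" for \<alpha>
  proof -
    have [measurable]: "monomial \<alpha> \<in> borel_measurable borel"
      unfolding monomial_def by measurable
    have "(LINT x|transport_measure a t \<mu>. monomial \<alpha> x) =
        ?c * exp (- (\<Sum>i\<in>UNIV. a $ i * real (\<alpha> i) * t)) * s \<alpha>"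
      by (simp add: transport_measure_def integral_density integral_distr monomial_dilation s)
    then show ?thesis
      by (simp add: transport_def algebra_simps sum.distrib flip: exp_add)
  qed
  ultimately show ?thesis
    by (simp add: representing_measure_def)
qed

text \<open>Any representing measure of the transported sequence, carried back by
  \<open>- t\<close>, represents \<open>s\<close> and therefore equals \<open>\<mu>\<close>;
  carrying it forward again identifies it.\<close>

lemma determinate_transport:
  assumes "determinate s"
  shows "determinate (transport a s t)"
proof -
  from assms obtain \<mu> where \<mu>: "representing_measure s \<mu>"
    and uniq: "\<And>\<nu>. representing_measure s \<nu> \<Longrightarrow> \<nu> = \<mu>"
    unfolding determinate_def by blast
  show ?thesis
    unfolding determinate_def
  proof (rule ex1I)
    show "representing_measure (transport a s t) (transport_measure a t \<mu>)"
      using \<mu> by (rule representing_measure_transport)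
  next
    fix \<nu> assume \<nu>: "representing_measure (transport a s t) \<nu>"
    have "transport_measure a (- t) \<nu> = \<mu>"
      using uniq representing_measure_transport[OF \<nu>, of a "- t"] by simp
    then show "\<nu> = transport_measure a t \<mu>"
      using transport_measure_minus[of \<nu> a "- t"] \<nu> by (simp add: representing_measure_def)
  qed
qed

section \<open>Density of polynomials under bounded densities and dilations\<close>

lemma L2_density_eq:
  assumes [measurable]: "r \<in> borel_measurable M"
    and r: "\<And>x. k \<le> r x" "\<And>x. r x \<le> K" and k: "0 < k"
  shows "L2 (density M (\<lambda>x. ennreal (r x))) = L2 M"
proof -
  have r0: "0 \<le> r x" for x
    using r(1)[of x] k by simp
  \<comment> \<open>The bounds on \<open>r\<close> make the two integrands dominate each other, with
    constants \<open>1 / k\<close> and \<open>K\<close>.\<close>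
  have "integrable M (\<lambda>x. r x * (cmod (f x))\<^sup>2) \<longleftrightarrow> integrable M (\<lambda>x. (cmod (f x))\<^sup>2)"
    if [measurable]: "f \<in> borel_measurable M" for f
  proof
    assume "integrable M (\<lambda>x. r x * (cmod (f x))\<^sup>2)"
    then have "integrable M (\<lambda>x. (1 / k) * (r x * (cmod (f x))\<^sup>2))"
      by (intro integrable_mult_right)
    then show "integrable M (\<lambda>x. (cmod (f x))\<^sup>2)"
    proof (rule Bochner_Integration.integrable_bound)
      show "AE x in M. norm ((cmod (f x))\<^sup>2) \<le> norm (1 / k * (r x * (cmod (f x))\<^sup>2))"
        using r(1) k by (auto simp: abs_mult r0 field_simps intro!: mult_right_mono)
    qed measurable
  next
    assume "integrable M (\<lambda>x. (cmod (f x))\<^sup>2)"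
    then have "integrable M (\<lambda>x. K * (cmod (f x))\<^sup>2)"
      by (intro integrable_mult_right)
    then show "integrable M (\<lambda>x. r x * (cmod (f x))\<^sup>2)"
    proof (rule Bochner_Integration.integrable_bound)
      show "AE x in M. norm (r x * (cmod (f x))\<^sup>2) \<le> norm (K * (cmod (f x))\<^sup>2)"
        using order_trans[OF r] k
        by (auto simp: abs_mult r0 order_trans[OF r0 r(2)] intro!: mult_right_mono r(2))
    qed measurable
  qed
  then show ?thesis
    by (auto simp: L2_def integrable_density r0)
qed

lemma L2_norm_density_le:
  assumes [measurable]: "r \<in> borel_measurable M"
    and r: "\<And>x. 0 \<le> r x" "\<And>x. r x \<le> K" and f: "f \<in> L2 M"
  shows "L2_norm (density M (\<lambda>x. ennreal (r x))) f \<le> sqrt K * L2_norm M f"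
proof -
  have [measurable]: "f \<in> borel_measurable M" and int: "integrable M (\<lambda>x. (cmod (f x))\<^sup>2)"
    using f by (auto simp: L2_def)
  have "(LINT x|density M (\<lambda>x. ennreal (r x)). (cmod (f x))\<^sup>2) = (LINT x|M. r x * (cmod (f x))\<^sup>2)"
    by (simp add: integral_density r)
  also have "\<dots> \<le> (LINT x|M. K * (cmod (f x))\<^sup>2)"
    by (rule integral_mono') (use int r in \<open>auto intro!: mult_right_mono mult_nonneg_nonneg intro: order_trans\<close>)
  also have "\<dots> = K * (LINT x|M. (cmod (f x))\<^sup>2)"
    by simp
  finally show ?thesis
    by (simp add: L2_norm_def flip: real_sqrt_mult)
qed

lemma L2_diff:
  assumes "f \<in> L2 M" "g \<in> L2 M"
  shows "(\<lambda>x. f x - g x) \<in> L2 M"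
proof -
  have [measurable]: "f \<in> borel_measurable M" "g \<in> borel_measurable M"
    and int: "integrable M (\<lambda>x. (cmod (f x))\<^sup>2)" "integrable M (\<lambda>x. (cmod (g x))\<^sup>2)"
    using assms by (auto simp: L2_def)
  have *: "(cmod (f x - g x))\<^sup>2 \<le> 2 * (cmod (f x))\<^sup>2 + 2 * (cmod (g x))\<^sup>2" for x
  proof -
    have "(cmod (f x - g x))\<^sup>2 \<le> (cmod (f x) + cmod (g x))\<^sup>2"
      by (intro power_mono norm_triangle_ineq4) simp
    also have "\<dots> \<le> 2 * (cmod (f x))\<^sup>2 + 2 * (cmod (g x))\<^sup>2"
      using sum_squares_bound[of "cmod (f x)" "cmod (g x)"] by (simp add: power2_sum)
    finally show ?thesis .
  qed
  have "integrable M (\<lambda>x. 2 * (cmod (f x))\<^sup>2 + 2 * (cmod (g x))\<^sup>2)"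
    using int by simp
  then have "integrable M (\<lambda>x. (cmod (f x - g x))\<^sup>2)"
    by (rule Bochner_Integration.integrable_bound) (use * in \<open>auto intro: order_trans\<close>)
  then show ?thesis
    by (simp add: L2_def)
qed

text \<open>Both measures have the same square-integrable functions, and passing to the new one
  enlarges the seminorm by at most \<open>sqrt K\<close>. Approximation within
  \<open>\<epsilon> / sqrt K\<close> for \<open>M\<close> is therefore enough.\<close>

lemma polynomials_dense_L2_density:
  assumes M: "polynomials_dense_L2 M" and [measurable]: "r \<in> borel_measurable M"
    and r: "\<And>x. k \<le> r x" "\<And>x. r x \<le> K" and k: "0 < k"
  shows "polynomials_dense_L2 (density M (\<lambda>x. ennreal (r x)))"
proof -
  let ?N = "density M (\<lambda>x. ennreal (r x))"
  have r0: "0 \<le> r x" for x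
    using r(1)[of x] k by simp
  have K: "0 < K"
    using order_trans[OF r] k by force
  have L2: "L2 ?N = L2 M"
    using r k by (intro L2_density_eq) auto
  have poly: "p \<in> L2 M" if "polynomial_function p" for p
    using M that by (simp add: polynomials_dense_L2_def)
  have "\<exists>p. polynomial_function p \<and> L2_norm ?N (\<lambda>x. f x - p x) < \<epsilon>"
    if f: "f \<in> L2 M" and \<epsilon>: "\<epsilon> > 0" for f \<epsilon>
  proof -
    from M f \<epsilon> K obtain p where p: "polynomial_function p"
      and less: "L2_norm M (\<lambda>x. f x - p x) < \<epsilon> / sqrt K"
      unfolding polynomials_dense_L2_def by (meson divide_pos_pos real_sqrt_gt_zero)
    have "L2_norm ?N (\<lambda>x. f x - p x) \<le> sqrt K * L2_norm M (\<lambda>x. f x - p x)"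
      using L2_diff[OF f poly[OF p]] r0 r(2) by (intro L2_norm_density_le) auto
    also have "\<dots> < \<epsilon>"
      using less K by (simp add: field_simps)
    finally show ?thesis
      using p by blast
  qed
  then show ?thesis
    using poly by (simp add: polynomials_dense_L2_def L2)
qed

text \<open>Composition with the dilation preserves the seminorm from \<open>L2\<close> of the image
  measure to \<open>L2 M\<close>, and it maps the polynomials onto the polynomials because the
  inverse is again a dilation.\<close>

lemma polynomials_dense_L2_dilation:
  assumes [measurable_cong]: "sets M = sets borel" and M: "polynomials_dense_L2 M"
  shows "polynomials_dense_L2 (distr M borel (dilation a t))"
proof -
  let ?N = "distr M borel (dilation a t)"
  have L2: "f \<in> L2 ?N \<longleftrightarrow> f \<in> borel_measurable borel \<and> (\<lambda>x. f (dilation a t x)) \<in> L2 M" for f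
  proof (cases "f \<in> borel_measurable borel")
    case True
    note this [measurable]
    show ?thesis
      by (simp add: L2_def integrable_distr_eq)
  qed (simp add: L2_def)
  have poly: "p \<in> L2 ?N" if p: "polynomial_function p" for p
  proof -
    have "p \<in> borel_measurable borel"
      using p by (intro borel_measurable_continuous_onI continuous_on_polymonial_function)
    moreover have "(\<lambda>x. p (dilation a t x)) \<in> L2 M"
      using M polynomial_function_compose[OF polynomial_function_dilation p]
      by (auto simp: polynomials_dense_L2_def comp_def)
    ultimately show ?thesis
      by (simp add: L2)
  qed
  have "\<exists>p. polynomial_function p \<and> L2_norm ?N (\<lambda>x. f x - p x) < \<epsilon>"
    if f: "f \<in> L2 ?N" and \<epsilon>: "\<epsilon> > 0" for f \<epsilon>
  proof -
    have [measurable]: "f \<in> borel_measurable borel" and f': "(\<lambda>x. f (dilation a t x)) \<in> L2 M"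
      using f by (auto simp: L2)
    from M have "\<forall>f\<in>L2 M. \<forall>\<epsilon>>0. \<exists>p. polynomial_function p \<and> L2_norm M (\<lambda>x. f x - p x) < \<epsilon>"
      by (simp add: polynomials_dense_L2_def)
    from bspec[OF this f'] \<epsilon> obtain p where p: "polynomial_function p"
      and less: "L2_norm M (\<lambda>x. f (dilation a t x) - p x) < \<epsilon>"
      by auto
    \<comment> \<open>With the inverse dilation built in, \<open>q\<close> composed with
      \<open>dilation a t\<close> is \<open>p\<close>.\<close>
    define q where "q = p \<circ> dilation a (- t)"
    have q: "polynomial_function q"
      unfolding q_def by (intro polynomial_function_compose polynomial_function_dilation p)
    have [measurable]: "q \<in> borel_measurable borel"
      using q by (intro borel_measurable_continuous_onI continuous_on_polymonial_function)
    have "L2_norm ?N (\<lambda>x. f x - q x) = L2_norm M (\<lambda>x. f (dilation a t x) - p x)"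
      by (simp add: L2_norm_def integral_distr) (simp add: q_def)
    then show ?thesis
      using q less by auto
  qed
  then show ?thesis
    using poly by (simp add: polynomials_dense_L2_def)
qed

text \<open>The weighted transported measure is the image of the weighted original measure times a
  density \<open>r\<close> bounded above and away from 0. The growth condition on \<open>w\<close>
  is used at \<open>t\<close> for the upper bound and at \<open>- t\<close> for the lower
  one.\<close>

lemma polynomials_dense_L2_transport_measure:
  fixes w :: "real ^ 'n::finite \<Rightarrow> real"
  assumes [measurable_cong]: "sets \<mu> = sets borel"
    and [measurable]: "w \<in> borel_measurable borel"
    and w0: "\<And>x. 0 < w x"
    and w: "\<And>t. \<exists>K. \<forall>x. w (dilation a t x) \<le> K * w x"
    and dense: "polynomials_dense_L2 (density \<mu> (\<lambda>x. ennreal (w x)))"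
  shows "polynomials_dense_L2 (density (transport_measure a t \<mu>) (\<lambda>x. ennreal (w x)))"
proof -
  let ?c = "exp (- (\<Sum>i\<in>UNIV. a $ i * t))" and ?D = "dilation a t" and ?D' = "dilation a (- t)"
  \<comment> \<open>Chosen so that \<open>w x * r (?D x) = ?c * w (?D x)\<close>: \<open>r\<close>
    trades the weight before dilating for the weight after it.\<close>
  define r where "r x = ?c * (w x / w (?D' x))" for x
  have [measurable]: "r \<in> borel_measurable borel"
    unfolding r_def by measurable
  from w obtain K where K: "\<And>x. w (?D x) \<le> K * w x"
    by blast
  from w obtain K' where K': "\<And>x. w (?D' x) \<le> K' * w x"
    by blast
  have K'0: "0 < K'"
    using K'[of 0] w0[of 0] w0[of "?D' 0"] by (smt (verit) mult_nonpos_nonneg)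
  have upper: "r x \<le> ?c * K" for x
    using K[of "?D' x"] w0 by (simp add: r_def divide_le_eq)
  have lower: "?c * (1 / K') \<le> r x" for x
    unfolding r_def using K'[of x] w0 K'0
    by (intro mult_left_mono) (simp_all add: field_simps)
  have r0: "0 \<le> r x" for x
    using w0 by (simp add: r_def less_imp_le)
  have "density (transport_measure a t \<mu>) (\<lambda>x. ennreal (w x)) =
      distr (density \<mu> (\<lambda>x. ennreal (?c * w (?D x)))) borel ?D"
    by (simp add: transport_measure_def density_density_eq density_distr ennreal_mult w0 less_imp_le)
  also have "\<dots> = distr (density (density \<mu> (\<lambda>x. ennreal (w x))) (\<lambda>x. ennreal (r (?D x)))) borel ?D"
  proof -
    have "?c * w (?D x) = w x * r (?D x)" for x
      using w0[of x] by (simp add: r_def)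
    then show ?thesis
      by (simp add: density_density_eq ennreal_mult w0 less_imp_le r0)
  qed
  also have "\<dots> = density (distr (density \<mu> (\<lambda>x. ennreal (w x))) borel ?D) (\<lambda>x. ennreal (r x))"
    by (simp add: density_distr)
  also have "polynomials_dense_L2 \<dots>"
  proof (rule polynomials_dense_L2_density[OF _ _ lower upper])
    show "polynomials_dense_L2 (distr (density \<mu> (\<lambda>x. ennreal (w x))) borel ?D)"
      using assms(1) dense by (intro polynomials_dense_L2_dilation) simp_all
    show "0 < ?c * (1 / K')"
      using K'0 by simp
  qed measurable
  finally show ?thesis .
qed

section \<open>The polynomial weights\<close>

lemma dilation_nth_square_le:
  "(dilation a t x $ i)\<^sup>2 \<le> exp (\<Sum>j\<in>UNIV. 2 * \<bar>a $ j * t\<bar>) * (x $ i)\<^sup>2"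
proof -
  \<comment> \<open>Summing over all coordinates gives one constant that serves every
    \<open>i\<close>.\<close>
  have "2 * \<bar>a $ i * t\<bar> \<le> (\<Sum>j\<in>UNIV. 2 * \<bar>a $ j * t\<bar>)"
    by (rule member_le_sum) auto
  then have "exp (2 * - (a $ i * t)) \<le> exp (\<Sum>j\<in>UNIV. 2 * \<bar>a $ j * t\<bar>)"
    by simp
  then show ?thesis
    by (simp add: power_mult_distrib mult_right_mono flip: exp_double)
qed

text \<open>
  The index sets \<open>{}\<close>, \<open>{i}\<close> and \<open>UNIV\<close> give the weights of strict, strong and
  ultradeterminacy.
\<close>

lemma weight_dilation_le:
  "\<exists>K. \<forall>x. 1 + (\<Sum>i\<in>I. (dilation a t x $ i)\<^sup>2) \<le> K * (1 + (\<Sum>i\<in>I. (x $ i)\<^sup>2))"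
proof (intro exI allI)
  fix x
  let ?K = "exp (\<Sum>j\<in>UNIV. 2 * \<bar>a $ j * t\<bar>)"
  have "(\<Sum>i\<in>I. (dilation a t x $ i)\<^sup>2) \<le> ?K * (\<Sum>i\<in>I. (x $ i)\<^sup>2)"
    unfolding sum_distrib_left by (intro sum_mono dilation_nth_square_le)
  \<comment> \<open>This lets \<open>?K\<close> absorb the constant term of the weight as
    well.\<close>
  moreover have "1 \<le> ?K"
    by (simp add: sum_nonneg)
  ultimately show "1 + (\<Sum>i\<in>I. (dilation a t x $ i)\<^sup>2) \<le> ?K * (1 + (\<Sum>i\<in>I. (x $ i)\<^sup>2))"
    unfolding distrib_left mult_1_right by (rule add_mono[rotated])
qed

lemma polynomials_dense_L2_transport_measure_weight:
  assumes "sets \<mu> = sets borel"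
    and "polynomials_dense_L2 (density \<mu> (\<lambda>x. ennreal (1 + (\<Sum>i\<in>I. (x $ i)\<^sup>2))))"
  shows "polynomials_dense_L2
    (density (transport_measure a t \<mu>) (\<lambda>x. ennreal (1 + (\<Sum>i\<in>I. (x $ i)\<^sup>2))))"
proof (rule polynomials_dense_L2_transport_measure[OF assms(1) _ _ weight_dilation_le assms(2)])
  show "0 < 1 + (\<Sum>i\<in>I. (x $ i)\<^sup>2)" for x :: "real ^ 'a"
    by (intro add_pos_nonneg sum_nonneg) auto
qed measurable

section \<open>Transport of the determinacy properties\<close>

lemma strictly_determinate_transport:
  assumes "strictly_determinate s"
  shows "strictly_determinate (transport a s t)"
proof -
  from assms obtain \<mu> where "determinate s" and \<mu>: "representing_measure s \<mu>"
    and "polynomials_dense_L2 \<mu>"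
    unfolding strictly_determinate_def by blast
  moreover from this have "polynomials_dense_L2 (transport_measure a t \<mu>)"
    \<comment> \<open>Over the empty index set the weight is 1, so both densities reduce to the
      measures themselves.\<close>
    using polynomials_dense_L2_transport_measure_weight[of \<mu> "{}" a t]
    by (simp add: representing_measure_def density_1)
  ultimately show ?thesis
    unfolding strictly_determinate_def
    using determinate_transport representing_measure_transport by blast
qed

lemma strongly_determinate_transport:
  assumes "strongly_determinate s"
  shows "strongly_determinate (transport a s t)"
proof -
  from assms obtain \<mu> where "determinate s" and \<mu>: "representing_measure s \<mu>"
    and "\<forall>i. polynomials_dense_L2 (density \<mu> (\<lambda>x. ennreal (1 + (x $ i)\<^sup>2)))"
    unfolding strongly_determinate_def by blast
  moreover from this have
    "\<forall>i. polynomials_dense_L2 (density (transport_measure a t \<mu>) (\<lambda>x. ennreal (1 + (x $ i)\<^sup>2)))"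
    using polynomials_dense_L2_transport_measure_weight[of \<mu> "{i}" a t for i]
    by (simp add: representing_measure_def)
  ultimately show ?thesis
    unfolding strongly_determinate_def
    using determinate_transport representing_measure_transport by blast
qed

lemma ultradeterminate_transport:
  assumes "ultradeterminate s"
  shows "ultradeterminate (transport a s t)"
proof -
  from assms obtain \<mu> where "determinate s" and \<mu>: "representing_measure s \<mu>"
    and "polynomials_dense_L2 (density \<mu> (\<lambda>x. ennreal (1 + (\<Sum>i\<in>UNIV. (x $ i)\<^sup>2))))"
    unfolding ultradeterminate_def by blast
  moreover from this have "polynomials_dense_L2
      (density (transport_measure a t \<mu>) (\<lambda>x. ennreal (1 + (\<Sum>i\<in>UNIV. (x $ i)\<^sup>2))))"
    using polynomials_dense_L2_transport_measure_weight[of \<mu> UNIV a t]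
    by (simp add: representing_measure_def)
  ultimately show ?thesis
    unfolding ultradeterminate_def
    using determinate_transport representing_measure_transport by blast
qed

theorem corollary3p7:
  fixes a :: "real ^ 'n::finite"
    and s :: "('n \<Rightarrow> nat) \<Rightarrow> real"
    and P :: "(('n \<Rightarrow> nat) \<Rightarrow> real) \<Rightarrow> bool"
  assumes "s \<in> moment_sequences"
    and "P \<in> {determinate, strictly_determinate, strongly_determinate, ultradeterminate}"
  shows "(P s \<longleftrightarrow> (\<exists>s'\<in>transport_curve a s. P s')) \<and>
         ((\<exists>s'\<in>transport_curve a s. P s') \<longleftrightarrow> (\<forall>s'\<in>transport_curve a s. P s'))"
proof -
  have transport: "P (transport a s t)" if "P s" for s t
    using assms(2) that determinate_transport strictly_determinate_transport
      strongly_determinate_transport ultradeterminate_transport by blast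
  \<comment> \<open>The converse transports back by \<open>- t\<close>, which returns
    \<open>s\<close>.\<close>
  have P_iff: "P (transport a s t) \<longleftrightarrow> P s" for t
    using transport[of s t] transport[of "transport a s t" "- t"] by auto
  \<comment> \<open>The curve contains \<open>s\<close> itself and so is nonempty; hence a property
    of all its points holds at some point.\<close>
  have "0 \<in> transport_domain a s"
    using assms(1) by (simp add: transport_domain_def)
  then show ?thesis
    unfolding transport_curve_def by (auto simp: P_iff)
qed

end
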